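(* Let $G$ be a finite group with unit element $e$, and let $S$ be a subset of $G$ such that $e \in S$ and $|S|$ divides $|G|$. Then $S$ is a group (i.e. a subgroup of $G$, under the multiplication of $G$) if and only if there exist a group $H$, with unit element $e'$, and a bijective map $\varphi : H \to S$ such that $\varphi(e') = e$ and $$ \Theta_{G}(S ; [x_{s}]) = \hat{\varphi} \left( \Theta(H)^{\frac{|G|}{|H|}} \right). $$
   Context: For a finite group $G$ and a subset $S \subseteq G$, let $x_s$ ($s \in S$) be independent commuting variables, put $[x_s] = \{x_s \mid s \in S\}$, and set $x_g = 0$ for $g \in G \setminus S$. The generalized group determinant of $G$ to $S$ in $[x_s]$ is $$\Theta_G(S;[x_s]) := \det\left(x_{gh^{-1}}\right)_{g,h \in G} \in \mathbb{C}[x_s],$$ where $\mathbb{C}[x_s]$ is the polynomial ring over $\mathbb{C}$ in the variables $[x_s]$; it does not depend on the ordering of the elements of $G$. For a finite group $H$, $\Theta(H) := \Theta_H(H;[x_h]) = \det(x_{gh^{-1}})_{g,h\in H}$, a polynomial in the independent commuting variables $x_h$ ($h \in H$), is the (ordinary) group determinant of $H$. A bijection $\varphi : H \to S$ induces the $\mathbb{C}$-algebra isomorphism $\hat\varphi$ from the polynomial ring over $\mathbb{C}$ in the variables $x_h$ ($h\in H$) to the polynomial ring over $\mathbb{C}$ in the variables $x_s$ ($s \in S$), determined by $x_h \mapsto x_{\varphi(h)}$. Here $|A|$ denotes the cardinality of $A$. Since $\varphi$ is a bijection onto $S$, $H$ is finite with $|H| = |S|$, so $|G|/|H|$ is a positive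 integer. *)

theory Defs
  imports
    "HOL-Library.Poly_Mapping"
    "HOL-Algebra.Group"
    "HOL-Algebra.Coset"
    "Jordan_Normal_Form.Determinant"
begin

text \<open>
  Polynomials over \<open>\<complex>\<close> in commuting variables indexed by \<open>'v\<close>, as finitely supported
  coefficient functions on exponent vectors with the convolution product of
  \<^theory>\<open>HOL-Library.Poly_Mapping\<close>.  For \<open>S :: 'v set\<close>, the ring \<open>\<complex>[x\<^sub>s | s \<in> S]\<close> is the
  subring \<open>polys_in S\<close>.
\<close>

type_synonym 'v cpoly = "('v \<Rightarrow>\<^sub>0 nat) \<Rightarrow>\<^sub>0 complex"

definition mvar :: "'v \<Rightarrow> 'v cpoly" where
  "mvar v = Poly_Mapping.single (Poly_Mapping.single v 1) 1"

definition mconst :: "complex \<Rightarrow> 'v cpoly" where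
  "mconst c = Poly_Mapping.single 0 c"

definition polys_in :: "'v set \<Rightarrow> 'v cpoly set" where
  "polys_in S = {p. \<forall>m \<in> Poly_Mapping.keys p. Poly_Mapping.keys m \<subseteq> S}"

text \<open>
  The algebra homomorphism determined by \<open>x\<^sub>v \<mapsto> x\<^bsub>\<phi> v\<^esub>\<close>: it sends \<open>\<Sum>\<^sub>m c\<^sub>m \<Prod>\<^sub>v x\<^sub>v ^ m\<^sub>v\<close> to
  \<open>\<Sum>\<^sub>m c\<^sub>m \<Prod>\<^sub>v x\<^bsub>\<phi> v\<^esub> ^ m\<^sub>v\<close>.
\<close>

definition subst_vars :: "('v \<Rightarrow> 'w) \<Rightarrow> 'v cpoly \<Rightarrow> 'w cpoly" where
  "subst_vars \<phi> p =
    (\<Sum>m \<in> Poly_Mapping.keys p. mconst (Poly_Mapping.lookup p m) *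
      (\<Prod>v \<in> Poly_Mapping.keys m. mvar (\<phi> v) ^ Poly_Mapping.lookup m v))"

lemma subst_vars_add: "subst_vars \<phi> (p + q) = subst_vars \<phi> p + subst_vars \<phi> q"
  unfolding subst_vars_def
  by (rule setsum_keys_plus_distrib)
    (simp_all add: mconst_def single_add distrib_right)

lemma subst_vars_single:
  "subst_vars \<phi> (Poly_Mapping.single m c) =
    mconst c * (\<Prod>v \<in> Poly_Mapping.keys m. mvar (\<phi> v) ^ Poly_Mapping.lookup m v)"
  by (simp add: subst_vars_def mconst_def)

lemma subst_vars_mconst: "subst_vars \<phi> (mconst c) = mconst c"
  by (simp add: mconst_def[of c] subst_vars_single)

lemma subst_vars_mvar: "subst_vars \<phi> (mvar v) = mvar (\<phi> v)"
  by (simp add: mvar_def[of v] subst_vars_single) (simp add: mconst_def)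

lemma subst_vars_mult:
  fixes \<phi> :: "'a \<Rightarrow> 'b"
  shows "subst_vars \<phi> (p * q) = subst_vars \<phi> p * subst_vars \<phi> q"
proof -
  let ?M = "\<lambda>m. \<Prod>v \<in> Poly_Mapping.keys m. mvar (\<phi> v) ^ Poly_Mapping.lookup m v"
  have M: "?M (m + n) = ?M m * ?M n" for m n :: "'a \<Rightarrow>\<^sub>0 nat"
  proof -
    let ?A = "Poly_Mapping.keys m \<union> Poly_Mapping.keys n"
    have ext: "?M k = (\<Prod>v \<in> ?A. mvar (\<phi> v) ^ Poly_Mapping.lookup k v)"
      if "Poly_Mapping.keys k \<subseteq> ?A" for k
      using that by (intro prod.mono_neutral_left) (auto simp: in_keys_iff)
    have "?M (m + n) = (\<Prod>v \<in> ?A. mvar (\<phi> v) ^ Poly_Mapping.lookup (m + n) v)"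
      by (intro ext keys_add)
    then show ?thesis
      by (simp add: ext[of m] ext[of n] lookup_add power_add prod.distrib)
  qed
  have upd: "Poly_Mapping.update a b f = Poly_Mapping.single a b + f"
    if "a \<notin> Poly_Mapping.keys f" for a b and f :: "'a cpoly"
    using that by (auto intro!: poly_mapping_eqI simp: lookup_update lookup_add lookup_single in_keys_iff)
  have single: "subst_vars \<phi> (Poly_Mapping.single m c * q) =
      subst_vars \<phi> (Poly_Mapping.single m c) * subst_vars \<phi> q" for m c and q :: "'a cpoly"
  proof (induction q rule: update_induct)
    case const
    show ?case by (simp add: subst_vars_def)
  next
    case (update f a b)
    have "mconst (c * b) = (mconst c * mconst b :: 'b cpoly)"
      by (simp add: mconst_def mult_single)
    then show ?case
      using update by (simp add: upd distrib_left subst_vars_add mult_single subst_vars_single M mult_ac)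
  qed
  show ?thesis
  proof (induction p rule: update_induct)
    case const
    show ?case by (simp add: subst_vars_def)
  next
    case (update f a b)
    then show ?case by (simp add: upd distrib_right subst_vars_add single)
  qed
qed

lemma subst_vars_sum: "subst_vars \<phi> (\<Sum>i \<in> I. f i) = (\<Sum>i \<in> I. subst_vars \<phi> (f i))"
proof (induction I rule: infinite_finite_induct)
  case (insert i I)
  then show ?case by (simp add: subst_vars_add)
qed (simp_all add: subst_vars_def)

lemma mconst_1: "mconst 1 = 1"
  by (simp add: mconst_def)

lemma subst_vars_1: "subst_vars \<phi> 1 = 1"
  using subst_vars_mconst[of \<phi> 1] by (simp add: mconst_1)

lemma subst_vars_prod: "subst_vars \<phi> (\<Prod>i \<in> I. f i) = (\<Prod>i \<in> I. subst_vars \<phi> (f i))"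
  by (induction I rule: infinite_finite_induct) (simp_all add: subst_vars_mult subst_vars_1)

lemma subst_vars_power: "subst_vars \<phi> (p ^ n) = subst_vars \<phi> p ^ n"
  by (induction n) (simp_all add: subst_vars_mult subst_vars_1)

lemma subst_vars_subst_vars: "subst_vars \<psi> (subst_vars \<phi> p) = subst_vars (\<lambda>v. \<psi> (\<phi> v)) p"
  unfolding subst_vars_def[of \<phi>] subst_vars_def[of "\<lambda>v. \<psi> (\<phi> v)"]
  by (simp add: subst_vars_sum subst_vars_mult subst_vars_mconst subst_vars_prod
      subst_vars_power subst_vars_mvar)

lemma subst_vars_ident:
  assumes p: "p \<in> polys_in S" and \<phi>: "\<And>v. v \<in> S \<Longrightarrow> \<phi> v = v"
  shows "subst_vars \<phi> p = p"
proof -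
  have pw: "mvar v ^ n = Poly_Mapping.single (Poly_Mapping.single v n) 1" for v :: 'a and n
    by (induction n) (simp_all add: mvar_def mult_single single_add[symmetric])
  have pr: "(\<Prod>v \<in> A. mvar v ^ Poly_Mapping.lookup m v) =
      Poly_Mapping.single (\<Sum>v \<in> A. Poly_Mapping.single v (Poly_Mapping.lookup m v)) 1"
    if "finite A" for A and m :: "'a \<Rightarrow>\<^sub>0 nat"
    using that by (induction A rule: finite_induct) (simp_all add: pw mult_single)
  have m: "(\<Sum>v \<in> Poly_Mapping.keys m. Poly_Mapping.single v (Poly_Mapping.lookup m v)) = m"
    for m :: "'a \<Rightarrow>\<^sub>0 nat"
    by (rule poly_mapping_eqI) (simp add: lookup_sum lookup_single when_def in_keys_iff)
  have \<phi>': "\<phi> v = v" if "m \<in> Poly_Mapping.keys p" "v \<in> Poly_Mapping.keys m" for m v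
    using p \<phi> that by (auto simp: polys_in_def)
  have "subst_vars \<phi> p = (\<Sum>m \<in> Poly_Mapping.keys p. mconst (Poly_Mapping.lookup p m) *
      (\<Prod>v \<in> Poly_Mapping.keys m. mvar v ^ Poly_Mapping.lookup m v))"
    unfolding subst_vars_def by (simp add: \<phi>')
  also have "\<dots> = (\<Sum>m \<in> Poly_Mapping.keys p. Poly_Mapping.single m (Poly_Mapping.lookup p m))"
    by (intro sum.cong refl) (simp only: pr finite_keys m, simp add: mconst_def mult_single)
  also have "\<dots> = p"
    by (rule poly_mapping_eqI) (simp add: lookup_sum lookup_single when_def in_keys_iff)
  finally show ?thesis .
qed

lemma polys_in_mconst: "mconst c \<in> polys_in S"
  by (simp add: polys_in_def mconst_def)

lemma polys_in_mvar: "v \<in> S \<Longrightarrow> mvar v \<in> polys_in S"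
  by (simp add: polys_in_def mvar_def)

lemma polys_in_add: "p \<in> polys_in S \<Longrightarrow> q \<in> polys_in S \<Longrightarrow> p + q \<in> polys_in S"
  using keys_add[of p q] unfolding polys_in_def by blast

lemma polys_in_mult:
  assumes "p \<in> polys_in S" "q \<in> polys_in S"
  shows "p * q \<in> polys_in S"
  unfolding polys_in_def
proof (clarify)
  fix m v assume "m \<in> Poly_Mapping.keys (p * q)" and v: "v \<in> Poly_Mapping.keys m"
  then obtain a b where "m = a + b" "a \<in> Poly_Mapping.keys p" "b \<in> Poly_Mapping.keys q"
    using keys_mult[of p q] by blast
  then show "v \<in> S" using assms v keys_add[of a b] unfolding polys_in_def by blast
qed

lemma polys_in_sum: "(\<And>i. i \<in> I \<Longrightarrow> f i \<in> polys_in S) \<Longrightarrow> (\<Sum>i \<in> I. f i) \<in> polys_in S"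
  by (induction I rule: infinite_finite_induct) (auto intro: polys_in_add, auto simp: polys_in_def)

lemma polys_in_prod: "(\<And>i. i \<in> I \<Longrightarrow> f i \<in> polys_in S) \<Longrightarrow> (\<Prod>i \<in> I. f i) \<in> polys_in S"
  by (induction I rule: infinite_finite_induct) (auto intro: polys_in_mult, auto simp: polys_in_def)

lemma polys_in_power: "p \<in> polys_in S \<Longrightarrow> p ^ n \<in> polys_in S"
  by (induction n) (auto intro: polys_in_mult, auto simp: polys_in_def)

lemma subst_vars_in:
  assumes "p \<in> polys_in A" "\<phi> ` A \<subseteq> B"
  shows "subst_vars \<phi> p \<in> polys_in B"
  unfolding subst_vars_def using assms
  by (intro polys_in_sum polys_in_mult polys_in_mconst polys_in_prod polys_in_power polys_in_mvar)
    (auto simp: polys_in_def)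

lemma subst_vars_bij:
  assumes "bij_betw \<phi> A B"
  shows "bij_betw (subst_vars \<phi>) (polys_in A) (polys_in B)"
proof (rule bij_betw_byWitness[where f' = "subst_vars (inv_into A \<phi>)"])
  show "\<forall>p \<in> polys_in A. subst_vars (inv_into A \<phi>) (subst_vars \<phi> p) = p"
    using assms by (auto simp: subst_vars_subst_vars bij_betw_inv_into_left intro!: subst_vars_ident)
  show "\<forall>q \<in> polys_in B. subst_vars \<phi> (subst_vars (inv_into A \<phi>) q) = q"
    using assms by (auto simp: subst_vars_subst_vars bij_betw_inv_into_right intro!: subst_vars_ident)
  show "subst_vars \<phi> ` polys_in A \<subseteq> polys_in B"
    using assms by (auto simp: bij_betw_def intro!: subst_vars_in)
  show "subst_vars (inv_into A \<phi>) ` polys_in B \<subseteq> polys_in A"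
    using bij_betw_inv_into[OF assms] by (auto simp: bij_betw_def intro!: subst_vars_in)
qed

text \<open>
  Determinant of a square matrix whose rows and columns are indexed by the finite set \<open>I\<close>.
  It agrees with the determinant of the matrix obtained from any enumeration of \<open>I\<close>; see
  \<open>det_on_eq_det\<close> below.
\<close>

definition det_on :: "'i set \<Rightarrow> ('i \<Rightarrow> 'i \<Rightarrow> 'r) \<Rightarrow> 'r :: comm_ring_1" where
  "det_on I A = (\<Sum>p | p permutes I. of_int (sign p) * (\<Prod>i \<in> I. A i (p i)))"

definition gen_group_det :: "('a, 'm) monoid_scheme \<Rightarrow> 'a set \<Rightarrow> 'a cpoly" where
  "gen_group_det G S =
    det_on (carrier G)
      (\<lambda>g h. if g \<otimes>\<^bsub>G\<^esub> inv\<^bsub>G\<^esub> h \<in> S then mvar (g \<otimes>\<^bsub>G\<^esub> inv\<^bsub>G\<^esub> h) else 0)"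

definition group_det :: "('a, 'm) monoid_scheme \<Rightarrow> 'a cpoly" where
  "group_det H = gen_group_det H (carrier H)"

lemma gen_group_det_in: "gen_group_det G S \<in> polys_in S"
proof -
  have "of_int (sign p) \<in> polys_in S" for p :: "'a \<Rightarrow> 'a"
    using polys_in_mconst[of "of_int (sign p)" S] by (simp add: mconst_def)
  moreover have "0 \<in> polys_in S"
    by (simp add: polys_in_def)
  ultimately show ?thesis
    unfolding gen_group_det_def det_on_def
    by (intro polys_in_sum polys_in_mult polys_in_prod) (auto intro: polys_in_mvar)
qed

lemma det_on_eq_det:
  fixes A :: "'i \<Rightarrow> 'i \<Rightarrow> 'r :: comm_ring_1"
  assumes e: "bij_betw e {0..<n} I"
  shows "det_on I A = det (mat n n (\<lambda>(i, j). A (e i) (e j)))"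
proof -
  let ?N = "{0..<n}"
  have bp: "bij_betw (map_permutation ?N e) {p. p permutes ?N} {p. p permutes I}"
  proof -
    have "(\<lambda>\<pi> x. if x \<in> I then e (\<pi> (inv_into ?N e x)) else x) = map_permutation ?N e"
      using e by (auto simp: map_permutation_def restrict_id_def fun_eq_iff bij_betw_def)
    with bij_betw_permutations[OF e] show ?thesis by simp
  qed
  have inj: "inj_on e ?N" using e by (rule bij_betw_imp_inj_on)
  have "det_on I A = (\<Sum>p | p permutes ?N. of_int (sign (map_permutation ?N e p)) *
      (\<Prod>i \<in> I. A i (map_permutation ?N e p i)))"
    unfolding det_on_def by (rule sum.reindex_bij_betw[OF bp, symmetric])
  also have "\<dots> = (\<Sum>p | p permutes ?N. of_int (sign p) * (\<Prod>i \<in> ?N. A (e i) (e (p i))))"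
  proof (rule sum.cong[OF refl])
    fix p assume "p \<in> {p. p permutes ?N}"
    then have p: "p permutes ?N" by simp
    have s: "sign (map_permutation ?N e p) = sign p"
      by (rule sign_map_permutation) (use p inj in auto)
    have "(\<Prod>i \<in> I. A i (map_permutation ?N e p i)) =
        (\<Prod>i \<in> ?N. A (e i) (map_permutation ?N e p (e i)))"
      by (rule prod.reindex_bij_betw[OF e, symmetric])
    also have "\<dots> = (\<Prod>i \<in> ?N. A (e i) (e (p i)))"
      by (intro prod.cong refl) (use inj p in \<open>auto simp: map_permutation_apply\<close>)
    finally show "of_int (sign (map_permutation ?N e p)) *
        (\<Prod>i \<in> I. A i (map_permutation ?N e p i)) =
        of_int (sign p) * (\<Prod>i \<in> ?N. A (e i) (e (p i)))" using s by simp
  qed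
  also have "\<dots> = det (mat n n (\<lambda>(i, j). A (e i) (e j)))"
    unfolding det_def
    by (auto intro!: sum.cong arg_cong2[of _ _ _ _ "(*)"] prod.cong dest: permutes_in_image)
  finally show ?thesis .
qed

end

theory Submission
  imports Defs "Jordan_Normal_Form.Schur_Decomposition"
begin

text \<open>
  If \<open>S\<close> is a subgroup, the entry at \<open>(g, h)\<close> vanishes unless \<open>g\<close> and \<open>h\<close> lie in the same right
  coset of \<open>S\<close>.  The matrix is then block diagonal, with the group matrix of \<open>S\<close> as the block of
  every coset, so that \<open>\<Theta>\<^sub>G(S) = \<Theta>(S) ^ (|G| / |S|)\<close> (\<open>gen_group_det_subgroup\<close>).

  For the converse, the determinant is used only through the traces of cubes.  The variable of
  the unit element occurs exactly on the diagonal.  Hence, for every complex weight \<open>x\<close> on \<open>S\<close>, the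
  identity \<open>\<Theta>\<^sub>G(S) = \<phi>(\<Theta>(H) ^ m)\<close> with \<open>m = |G| / |H|\<close> implies that the characteristic polynomial of
  the group matrix \<open>A = (x (g h\<inverse>))\<close> of \<open>G\<close> is the \<open>m\<close>-th power of the characteristic polynomial
  of the corresponding group matrix \<open>B\<close> of \<open>H\<close>.  The eigenvalues of \<open>A\<close> are therefore those of \<open>B\<close>
  repeated \<open>m\<close> times, and \<open>tr A\<^sup>3 = m tr B\<^sup>3\<close> (\<open>trace_cube_char_poly_power\<close>).  Here \<open>tr A\<^sup>3\<close> is
  \<open>|G|\<close> times the sum of \<open>x a * x b * x c\<close> over all triples with \<open>a b c = 1\<close>, and likewise for \<open>H\<close>.
  As this holds for all \<open>x\<close>, polarisation compares the triples one by one: for \<open>a, b, c \<in> H\<close>, the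
  number of true statements among \<open>\<phi>(a) \<phi>(b) \<phi>(c) = 1\<close> and \<open>\<phi>(a) \<phi>(c) \<phi>(b) = 1\<close> is the number of
  true statements among \<open>a b c = 1\<close> and \<open>a c b = 1\<close> (\<open>triple_product_counts\<close>).

  It follows that \<open>\<phi>\<close> respects inverses and maps \<open>{a b, b a}\<close> onto \<open>{\<phi>(a) \<phi>(b), \<phi>(b) \<phi>(a)}\<close>, with
  the two sets having one element or two at the same time.  So \<open>S = \<phi>(H)\<close> is closed under inverses
  and products (\<open>subgroup_of_triple_product_counts\<close>), although \<open>\<phi>\<close> need not be a homomorphism.
\<close>

section \<open>Evaluation of polynomials at complex points\<close>

definition eval_cpoly :: "('v \<Rightarrow> complex) \<Rightarrow> 'v cpoly \<Rightarrow> complex" where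
  "eval_cpoly x p = (\<Sum>m \<in> Poly_Mapping.keys p. Poly_Mapping.lookup p m *
      (\<Prod>v \<in> Poly_Mapping.keys m. x v ^ Poly_Mapping.lookup m v))"

lemma eval_cpoly_add: "eval_cpoly x (p + q) = eval_cpoly x p + eval_cpoly x q"
  unfolding eval_cpoly_def
  by (rule setsum_keys_plus_distrib) (simp_all add: distrib_right)

lemma eval_cpoly_0 [simp]: "eval_cpoly x 0 = 0"
  by (simp add: eval_cpoly_def)

lemma eval_cpoly_sum: "eval_cpoly x (\<Sum>i \<in> I. f i) = (\<Sum>i \<in> I. eval_cpoly x (f i))"
  by (induction I rule: infinite_finite_induct) (simp_all add: eval_cpoly_add)

lemma eval_cpoly_single:
  "eval_cpoly x (Poly_Mapping.single m c) =
    c * (\<Prod>v \<in> Poly_Mapping.keys m. x v ^ Poly_Mapping.lookup m v)"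
  by (simp add: eval_cpoly_def)

lemma eval_cpoly_mconst [simp]: "eval_cpoly x (mconst c) = c"
  by (simp add: mconst_def eval_cpoly_single)

lemma eval_cpoly_mvar [simp]: "eval_cpoly x (mvar v) = x v"
  by (simp add: mvar_def eval_cpoly_single)

lemma cpoly_sum_monomials:
  fixes p :: "'v cpoly"
  shows "p = (\<Sum>m \<in> Poly_Mapping.keys p. Poly_Mapping.single m (Poly_Mapping.lookup p m))"
  by (rule poly_mapping_eqI) (simp add: lookup_sum lookup_single when_def in_keys_iff)

lemma eval_monomial_add:
  fixes x :: "'v \<Rightarrow> complex" and m n :: "'v \<Rightarrow>\<^sub>0 nat"
  defines "M \<equiv> \<lambda>k. \<Prod>v \<in> Poly_Mapping.keys k. x v ^ Poly_Mapping.lookup k v"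
  shows "M (m + n) = M m * M n"
proof -
  let ?A = "Poly_Mapping.keys m \<union> Poly_Mapping.keys n"
  have "M k = (\<Prod>v \<in> ?A. x v ^ Poly_Mapping.lookup k v)"
    if "Poly_Mapping.keys k \<subseteq> ?A" for k
    unfolding M_def using that by (intro prod.mono_neutral_left) (auto simp: in_keys_iff)
  then show ?thesis
    using keys_add[of m n] by (simp add: lookup_add power_add prod.distrib)
qed

lemma eval_cpoly_mult: "eval_cpoly x (p * q) = eval_cpoly x p * eval_cpoly x q"
proof -
  let ?s = "\<lambda>p m. Poly_Mapping.single m (Poly_Mapping.lookup p m) :: 'a cpoly"
  have "eval_cpoly x (p * q) =
      eval_cpoly x ((\<Sum>m \<in> Poly_Mapping.keys p. ?s p m) * (\<Sum>n \<in> Poly_Mapping.keys q. ?s q n))"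
    by (simp flip: cpoly_sum_monomials)
  also have "\<dots> = (\<Sum>m \<in> Poly_Mapping.keys p. eval_cpoly x (?s p m)) *
      (\<Sum>n \<in> Poly_Mapping.keys q. eval_cpoly x (?s q n))"
    by (simp add: sum_product eval_cpoly_sum mult_single eval_cpoly_single eval_monomial_add mult_ac)
  also have "\<dots> = eval_cpoly x p * eval_cpoly x q"
    by (simp flip: cpoly_sum_monomials eval_cpoly_sum)
  finally show ?thesis .
qed

lemma eval_cpoly_1 [simp]: "eval_cpoly x 1 = 1"
  using eval_cpoly_mconst[of x 1] by (simp add: mconst_1)

lemma eval_cpoly_prod: "eval_cpoly x (\<Prod>i \<in> I. f i) = (\<Prod>i \<in> I. eval_cpoly x (f i))"
  by (induction I rule: infinite_finite_induct) (simp_all add: eval_cpoly_mult)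

lemma eval_cpoly_power: "eval_cpoly x (p ^ n) = eval_cpoly x p ^ n"
  by (induction n) (simp_all add: eval_cpoly_mult)

lemma eval_cpoly_of_int [simp]: "eval_cpoly x (of_int k) = of_int k"
  using eval_cpoly_mconst[of x "of_int k"] by (simp add: mconst_def)

lemma eval_cpoly_subst_vars: "eval_cpoly x (subst_vars \<phi> p) = eval_cpoly (x \<circ> \<phi>) p"
  by (simp add: subst_vars_def eval_cpoly_sum eval_cpoly_mult eval_cpoly_prod eval_cpoly_power
      eval_cpoly_def[of "x \<circ> \<phi>"])

lemma eval_cpoly_det_on: "eval_cpoly x (det_on I A) = det_on I (\<lambda>i j. eval_cpoly x (A i j))"
  by (simp add: det_on_def eval_cpoly_sum eval_cpoly_mult eval_cpoly_prod)

section \<open>Characteristic polynomials and traces of cubes\<close>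

text \<open>
  The trace of \<open>A\<^sup>3\<close>, written as a sum over closed walks of length three, which is the form in
  which the entries of a group matrix can be read off.
\<close>

definition trace_cube :: "nat \<Rightarrow> complex mat \<Rightarrow> complex" where
  "trace_cube n A = (\<Sum>i<n. \<Sum>j<n. \<Sum>k<n. A $$ (i, j) * A $$ (j, k) * A $$ (k, i))"

lemma trace_mult_commute:
  fixes A B :: "'r :: comm_semiring_0 mat"
  assumes "A \<in> carrier_mat n n" "B \<in> carrier_mat n n"
  shows "(\<Sum>i<n. (A * B) $$ (i, i)) = (\<Sum>i<n. (B * A) $$ (i, i))"
proof -
  have "(\<Sum>i<n. (A * B) $$ (i, i)) = (\<Sum>i<n. \<Sum>j<n. A $$ (i, j) * B $$ (j, i))"
    using assms by (simp add: scalar_prod_def lessThan_atLeast0)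
  also have "\<dots> = (\<Sum>j<n. \<Sum>i<n. B $$ (j, i) * A $$ (i, j))"
    by (subst sum.swap) (simp add: mult.commute)
  also have "\<dots> = (\<Sum>i<n. (B * A) $$ (i, i))"
    using assms by (simp add: scalar_prod_def lessThan_atLeast0)
  finally show ?thesis .
qed

lemma trace_cube_pow:
  assumes A: "A \<in> carrier_mat n n"
  shows "trace_cube n A = (\<Sum>i<n. (A ^\<^sub>m 3) $$ (i, i))"
proof -
  have "(A ^\<^sub>m 3) $$ (i, i) = (\<Sum>j<n. \<Sum>k<n. A $$ (i, j) * A $$ (j, k) * A $$ (k, i))"
    if i: "i < n" for i
  proof -
    have "(A ^\<^sub>m 3) $$ (i, i) = (A * (A * A)) $$ (i, i)"
      using A by (simp add: numeral_3_eq_3)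
    also have "\<dots> = (\<Sum>j<n. A $$ (i, j) * (\<Sum>k<n. A $$ (j, k) * A $$ (k, i)))"
      using A i by (simp add: scalar_prod_def lessThan_atLeast0)
    also have "\<dots> = (\<Sum>j<n. \<Sum>k<n. A $$ (i, j) * A $$ (j, k) * A $$ (k, i))"
      by (simp add: sum_distrib_left mult.assoc)
    finally show ?thesis .
  qed
  then show ?thesis by (simp add: trace_cube_def)
qed

text \<open>
  A closed walk that is not constant moves to a smaller index at some step, and the entry for
  that step lies below the diagonal.  So only the constant walks contribute.
\<close>

lemma trace_cube_upper_triangular:
  assumes B: "B \<in> carrier_mat n n" and ut: "upper_triangular B"
  shows "trace_cube n B = (\<Sum>i<n. (B $$ (i, i)) ^ 3)"
proof -
  have z: "B $$ (i, j) * B $$ (j, k) * B $$ (k, i) = 0"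
    if "i < n" "j < n" "k < n" "\<not> (j = i \<and> k = i)" for i j k
  proof -
    have "j < i \<or> k < j \<or> i < k" using that by linarith
    then show ?thesis using upper_triangularD[OF ut] B that by auto
  qed
  have "(\<Sum>j<n. \<Sum>k<n. B $$ (i, j) * B $$ (j, k) * B $$ (k, i)) = (B $$ (i, i)) ^ 3"
    if i: "i < n" for i
  proof -
    have "(\<Sum>j<n. \<Sum>k<n. B $$ (i, j) * B $$ (j, k) * B $$ (k, i)) =
        (\<Sum>j<n. \<Sum>k<n. if k = i then if j = i then (B $$ (i, i)) ^ 3 else 0 else 0)"
      using z i by (intro sum.cong refl) (auto simp: power3_eq_cube)
    also have "\<dots> = (B $$ (i, i)) ^ 3" using i by simp
    finally show ?thesis .
  qed
  then show ?thesis by (simp add: trace_cube_def)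
qed

text \<open>
  By Schur's theorem \<open>A\<close> is similar to an upper triangular matrix whose diagonal lists the roots
  of the characteristic polynomial, and the trace of a cube is invariant under similarity.
\<close>

lemma trace_cube_eq_proots:
  assumes A: "A \<in> carrier_mat n n"
  shows "trace_cube n A = (\<Sum>a \<in># proots (char_poly A). a ^ 3)"
proof -
  obtain es where es: "char_poly A = (\<Prod>e \<leftarrow> es. [:- e, 1:])"
    using char_poly_factorized[OF A] by blast
  obtain B P Q where "schur_decomposition A es = (B, P, Q)"
    by (cases "schur_decomposition A es") auto
  with schur_decomposition[OF A es]
  have wit: "similar_mat_wit A B P Q" and ut: "upper_triangular B" and diag: "diag_mat B = es"
    by auto
  have B: "B \<in> carrier_mat n n" and P: "P \<in> carrier_mat n n" and Q: "Q \<in> carrier_mat n n"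
    and QP: "Q * P = 1\<^sub>m n"
    using similar_mat_witD2[OF A wit] by auto
  have B3: "B ^\<^sub>m 3 \<in> carrier_mat n n" using B by simp
  have "trace_cube n A = (\<Sum>i<n. (P * B ^\<^sub>m 3 * Q) $$ (i, i))"
    by (simp add: trace_cube_pow[OF A] similar_mat_wit_pow_id[OF wit])
  also have "\<dots> = (\<Sum>i<n. (Q * (P * B ^\<^sub>m 3)) $$ (i, i))"
    by (rule trace_mult_commute) (use P B3 Q in auto)
  also have "Q * (P * B ^\<^sub>m 3) = B ^\<^sub>m 3"
    using assoc_mult_mat[OF Q P B3] QP left_mult_one_mat[OF B3] by metis
  also have "(\<Sum>i<n. (B ^\<^sub>m 3) $$ (i, i)) = trace_cube n B"
    by (simp add: trace_cube_pow[OF B])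
  also have "\<dots> = (\<Sum>i<n. (B $$ (i, i)) ^ 3)"
    by (rule trace_cube_upper_triangular[OF B ut])
  also have "\<dots> = (\<Sum>e \<leftarrow> es. e ^ 3)"
    using B by (simp add: diag[symmetric] diag_mat_def sum_list_sum_nth lessThan_atLeast0)
  also have "\<dots> = (\<Sum>a \<in># mset es. a ^ 3)"
    by (metis mset_map sum_mset_sum_list)
  also have "mset es = proots (char_poly A)"
  proof -
    have "proots (\<Prod>e \<leftarrow> es. [:- e, 1:]) = mset es"
    proof (induction es)
      case (Cons e es)
      have "(\<Prod>e \<leftarrow> es. [:- e, 1:]) \<noteq> 0"
        by (auto simp: prod_list_zero_iff)
      then have "proots ([:- e, 1:] * (\<Prod>e \<leftarrow> es. [:- e, 1:])) =
          {#e#} + proots (\<Prod>e \<leftarrow> es. [:- e, 1:])"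
        by (subst proots_mult) simp_all
      then show ?case using Cons by (simp only: list.map prod_list.Cons mset.simps) simp
    qed simp
    then show ?thesis by (simp add: es)
  qed
  finally show ?thesis .
qed

lemma sum_mset_repeat_mset:
  "(\<Sum>a \<in># repeat_mset m M. f a) = of_nat m * (\<Sum>a \<in># M. f a :: 'r :: comm_semiring_1)"
proof (induction m)
  case (Suc m)
  have "(\<Sum>a \<in># repeat_mset (Suc m) M. f a) = (\<Sum>a \<in># M. f a) + (\<Sum>a \<in># repeat_mset m M. f a)"
    by simp
  then show ?case
    by (simp only: Suc of_nat_Suc distrib_right mult_1_left)
qed simp

text \<open>
  The step that turns a determinant identity into an identity of traces: the roots of
  \<open>char_poly A\<close> are those of \<open>char_poly B\<close> with their multiplicities multiplied by \<open>m\<close>.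
\<close>

lemma trace_cube_char_poly_power:
  assumes "A \<in> carrier_mat n n" "B \<in> carrier_mat r r" "char_poly A = char_poly B ^ m"
  shows "trace_cube n A = of_nat m * trace_cube r B"
  by (simp only: trace_cube_eq_proots[OF assms(1)] trace_cube_eq_proots[OF assms(2)] assms(3)
      proots_power sum_mset_repeat_mset)

lemma poly_char_poly:
  fixes A :: "'r :: comm_ring_1 mat"
  assumes A: "A \<in> carrier_mat n n"
  shows "poly (char_poly A) t = det (mat n n (\<lambda>(i, j). (if i = j then t else 0) - A $$ (i, j)))"
proof -
  have "comm_ring_hom (\<lambda>p :: 'r poly. poly p t)"
    by unfold_locales auto
  then have "poly (char_poly A) t = det (map_mat (\<lambda>p. poly p t) (char_poly_matrix A))"
    unfolding char_poly_def by (rule comm_ring_hom.hom_det[symmetric])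
  also have "map_mat (\<lambda>p. poly p t) (char_poly_matrix A) =
      mat n n (\<lambda>(i, j). (if i = j then t else 0) - A $$ (i, j))"
    using A by (intro eq_matI) (auto simp: char_poly_matrix_def)
  finally show ?thesis .
qed

section \<open>Determinants of block matrices\<close>

text \<open>
  Rows and columns are renamed by the same bijection, so no sign appears.
\<close>

lemma det_on_reindex:
  assumes "finite I" and f: "bij_betw f I J"
  shows "det_on J A = det_on I (\<lambda>i j. A (f i) (f j))"
proof -
  obtain e where e: "bij_betw e {0..<card I} I"
    using ex_bij_betw_nat_finite[OF \<open>finite I\<close>] by blast
  show ?thesis
    using det_on_eq_det[OF bij_betw_trans[OF e f], of A] det_on_eq_det[OF e, of "\<lambda>i j. A (f i) (f j)"]
    by simp
qed

text \<open>
  A permutation that does not map \<open>I\<close> into \<open>I\<close> picks an entry of the zero block.  One that does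
  is in a unique way the product of a permutation of \<open>I\<close> and one of \<open>J\<close>, and its sign and its
  product of entries split accordingly.
\<close>

lemma det_on_Un:
  fixes A :: "'i \<Rightarrow> 'i \<Rightarrow> 'r :: comm_ring_1"
  assumes fin: "finite I" "finite J" and disj: "I \<inter> J = {}"
    and zero: "\<And>i j. i \<in> I \<Longrightarrow> j \<in> J \<Longrightarrow> A i j = 0"
  shows "det_on (I \<union> J) A = det_on I A * det_on J A"
proof -
  let ?term = "\<lambda>K p. of_int (sign p) * (\<Prod>i \<in> K. A i (p i)) :: 'r"
  let ?R = "{r. r permutes I \<union> J \<and> r ` I \<subseteq> I}"
  let ?PQ = "{p. p permutes I} \<times> {q. q permutes J}"
  have vanish: "?term (I \<union> J) r = 0" if r: "r permutes I \<union> J" and nI: "\<not> r ` I \<subseteq> I" for r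
  proof -
    obtain i where "i \<in> I" "r i \<in> J"
      using nI permutes_in_image[OF r] by blast
    then have "\<exists>i \<in> I \<union> J. A i (r i) = 0" using zero by blast
    then have "(\<Prod>i \<in> I \<union> J. A i (r i)) = 0" using fin by (intro prod_zero) auto
    then show ?thesis by simp
  qed
  have stable: "bij_betw r I I" "bij_betw r J J" if "r permutes I \<union> J" "r ` I \<subseteq> I" for r
  proof -
    have inj: "inj r" using that(1) by (rule permutes_inj)
    have I: "r ` I = I"
      using that(2) fin card_image[OF inj_on_subset[OF inj subset_UNIV]] by (intro card_subset_eq) auto
    have "r ` (I \<union> J) = I \<union> J" using that(1) by (rule permutes_image)
    moreover have "(I \<union> J) - I = J" using disj by blast
    ultimately have "r ` J = J" using I image_set_diff[OF inj, of "I \<union> J" I] by simp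
    with I show "bij_betw r I I" "bij_betw r J J"
      using inj_on_subset[OF inj subset_UNIV] by (simp_all add: bij_betw_def)
  qed
  have "det_on (I \<union> J) A = (\<Sum>r \<in> ?R. ?term (I \<union> J) r)"
    unfolding det_on_def
    by (rule sum.mono_neutral_right) (use fin vanish in \<open>auto simp: finite_permutations\<close>)
  also have "\<dots> = (\<Sum>(p, q) \<in> ?PQ. ?term I p * ?term J q)"
  proof (rule sum.reindex_bij_witness[of _ "\<lambda>(p, q). p \<circ> q" "\<lambda>r. (restrict_id r I, restrict_id r J)"])
    fix r assume r: "r \<in> ?R"
    then have rp: "r permutes I \<union> J" by simp
    have p: "restrict_id r I permutes I" and q: "restrict_id r J permutes J"
      using stable[of r] r by (auto intro: permutes_restrict_id)
    have comp: "restrict_id r I \<circ> restrict_id r J = r"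
    proof
      fix x
      have "r x \<in> J" if "x \<in> J" using stable(2)[of r] r that by (auto simp: bij_betw_def)
      then show "(restrict_id r I \<circ> restrict_id r J) x = r x"
        using disj rp by (auto simp: restrict_id_def permutes_def)
    qed
    show "(case (restrict_id r I, restrict_id r J) of (p, q) \<Rightarrow> p \<circ> q) = r"
      using comp by simp
    show "(restrict_id r I, restrict_id r J) \<in> ?PQ" using p q by simp
    have "sign r = sign (restrict_id r I) * sign (restrict_id r J)"
      using sign_compose[of "restrict_id r I" "restrict_id r J"] p q fin
      by (auto simp: comp permutation_permutes)
    moreover have "(\<Prod>i \<in> I \<union> J. A i (r i)) =
        (\<Prod>i \<in> I. A i (restrict_id r I i)) * (\<Prod>i \<in> J. A i (restrict_id r J i))"
      using fin disj by (simp add: prod.union_disjoint)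
    ultimately show "(case (restrict_id r I, restrict_id r J) of (p, q) \<Rightarrow> ?term I p * ?term J q) =
        ?term (I \<union> J) r"
      by (simp add: mult_ac)
  next
    fix pq assume "pq \<in> ?PQ"
    then obtain p q where pq: "pq = (p, q)" and p: "p permutes I" and q: "q permutes J" by auto
    have on_I: "(p \<circ> q) x = p x" if "x \<in> I" for x
      using that q disj by (auto simp: permutes_def)
    have on_J: "(p \<circ> q) x = q x" if "x \<in> J" for x
      using permutes_in_image[OF q] that p disj by (auto simp: permutes_def)
    have "restrict_id (p \<circ> q) I = p" "restrict_id (p \<circ> q) J = q"
      using on_I on_J permutes_not_in[OF p] permutes_not_in[OF q]
      by (auto simp: restrict_id_def fun_eq_iff)
    then show "(restrict_id (case pq of (p, q) \<Rightarrow> p \<circ> q) I,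
        restrict_id (case pq of (p, q) \<Rightarrow> p \<circ> q) J) = pq"
      by (simp add: pq)
    have "p permutes I \<union> J" "q permutes I \<union> J"
      using p q by (auto intro: permutes_subset)
    then have "p \<circ> q permutes I \<union> J" by (rule permutes_compose[rotated])
    moreover have "(p \<circ> q) ` I \<subseteq> I"
      using on_I permutes_in_image[OF p] by (auto simp del: o_apply)
    ultimately show "(case pq of (p, q) \<Rightarrow> p \<circ> q) \<in> ?R" by (simp add: pq)
  qed
  also have "\<dots> = det_on I A * det_on J A"
    unfolding det_on_def by (simp add: sum_product sum.cartesian_product)
  finally show ?thesis .
qed

lemma det_on_Union:
  fixes A :: "'i \<Rightarrow> 'i \<Rightarrow> 'r :: comm_ring_1"
  assumes "finite \<C>" "\<And>C. C \<in> \<C> \<Longrightarrow> finite C" "pairwise disjnt \<C>"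
    and "\<And>C D i j. C \<in> \<C> \<Longrightarrow> D \<in> \<C> \<Longrightarrow> C \<noteq> D \<Longrightarrow> i \<in> C \<Longrightarrow> j \<in> D \<Longrightarrow> A i j = 0"
  shows "det_on (\<Union>\<C>) A = (\<Prod>C \<in> \<C>. det_on C A)"
  using assms
proof (induction \<C> rule: finite_induct)
  case empty
  show ?case by (simp add: det_on_def)
next
  case (insert C \<C>)
  have "det_on (C \<union> \<Union>\<C>) A = det_on C A * det_on (\<Union>\<C>) A"
  proof (rule det_on_Un)
    show "C \<inter> \<Union>\<C> = {}"
      using insert.prems(2) insert.hyps(2) by (fastforce simp: pairwise_def disjnt_def)
    show "A i j = 0" if "i \<in> C" "j \<in> \<Union>\<C>" for i j
      using insert.prems(3)[of C] insert.hyps(2) that by blast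
  qed (use insert in auto)
  moreover have "det_on (\<Union>\<C>) A = (\<Prod>C \<in> \<C>. det_on C A)"
  proof (rule insert.IH)
    show "A i j = 0" if "D \<in> \<C>" "E \<in> \<C>" "D \<noteq> E" "i \<in> D" "j \<in> E" for D E i j
      using insert.prems(3)[of D E i j] that by simp
  qed (use insert.prems in \<open>auto simp: pairwise_insert\<close>)
  ultimately show ?case using insert.hyps by simp
qed

section \<open>The determinant of a subgroup\<close>

text \<open>
  The entry at \<open>(g, h)\<close> is nonzero only if \<open>g h\<inverse> \<in> S\<close>, that is, if \<open>g\<close> and \<open>h\<close> lie in the same
  right coset of \<open>S\<close>.  On the coset of \<open>c\<close> the block is the group matrix of \<open>S\<close>, because
  \<open>(s c) (t c)\<inverse> = s t\<inverse>\<close>.  So the determinant is a product of copies of the group determinant of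
  \<open>S\<close>, one for each coset.
\<close>

lemma gen_group_det_subgroup:
  fixes G :: "('a, 'm) monoid_scheme"
  assumes G: "group G" "finite (carrier G)" and S: "subgroup S G"
    and H: "group H" "carrier H = S" "\<And>a b. a \<in> S \<Longrightarrow> b \<in> S \<Longrightarrow> a \<otimes>\<^bsub>H\<^esub> b = a \<otimes>\<^bsub>G\<^esub> b"
      "\<one>\<^bsub>H\<^esub> = \<one>\<^bsub>G\<^esub>"
  shows "gen_group_det G S = group_det H ^ (card (carrier G) div card S)"
proof -
  interpret G: group G by fact
  interpret H: group H by fact
  interpret S: subgroup S G by fact
  let ?A = "\<lambda>g h. if g \<otimes>\<^bsub>G\<^esub> inv\<^bsub>G\<^esub> h \<in> S then mvar (g \<otimes>\<^bsub>G\<^esub> inv\<^bsub>G\<^esub> h) else 0"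
  have finS: "finite S" using G(2) S.subset finite_subset by blast
  have inv: "inv\<^bsub>H\<^esub> b = inv\<^bsub>G\<^esub> b" if "b \<in> S" for b
    using that by (intro H.inv_equality) (auto simp: H(2,3,4))
  have block: "det_on C ?A = group_det H" if "C \<in> rcosets\<^bsub>G\<^esub> S" for C
  proof -
    obtain c where c: "c \<in> carrier G" and C: "C = (\<lambda>s. s \<otimes>\<^bsub>G\<^esub> c) ` S"
      using \<open>C \<in> rcosets\<^bsub>G\<^esub> S\<close> by (auto simp: RCOSETS_def r_coset_def)
    have bij: "bij_betw (\<lambda>s. s \<otimes>\<^bsub>G\<^esub> c) S C"
      unfolding C by (rule inj_on_imp_bij_betw) (use c in \<open>auto intro!: inj_onI\<close>)
    have cancel: "s \<otimes>\<^bsub>G\<^esub> c \<otimes>\<^bsub>G\<^esub> inv\<^bsub>G\<^esub> (t \<otimes>\<^bsub>G\<^esub> c) = s \<otimes>\<^bsub>H\<^esub> inv\<^bsub>H\<^esub> t" if "s \<in> S" "t \<in> S" for s t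
    proof -
      have "s \<otimes>\<^bsub>G\<^esub> c \<otimes>\<^bsub>G\<^esub> inv\<^bsub>G\<^esub> (t \<otimes>\<^bsub>G\<^esub> c) = s \<otimes>\<^bsub>G\<^esub> (c \<otimes>\<^bsub>G\<^esub> inv\<^bsub>G\<^esub> c) \<otimes>\<^bsub>G\<^esub> inv\<^bsub>G\<^esub> t"
        using c that by (simp add: G.inv_mult_group G.m_assoc del: G.r_inv G.Units_r_inv)
      then show ?thesis using c that by (simp add: inv H(3))
    qed
    have "det_on C ?A = det_on S (\<lambda>s t. ?A (s \<otimes>\<^bsub>G\<^esub> c) (t \<otimes>\<^bsub>G\<^esub> c))"
      by (rule det_on_reindex[OF finS bij])
    also have "\<dots> = group_det H"
      unfolding group_det_def gen_group_det_def det_on_def H(2)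
      by (intro sum.cong refl arg_cong2[of _ _ _ _ "(*)"] prod.cong)
        (auto simp: cancel permutes_in_image)
    finally show ?thesis .
  qed
  have "gen_group_det G S = det_on (\<Union>(rcosets\<^bsub>G\<^esub> S)) ?A"
    by (simp add: gen_group_det_def G.rcosets_part_G[OF S])
  also have "\<dots> = (\<Prod>C \<in> rcosets\<^bsub>G\<^esub> S. det_on C ?A)"
  proof (rule det_on_Union)
    show "finite (rcosets\<^bsub>G\<^esub> S)"
      using G.rcosets_part_G[OF S] G(2) by (simp add: finite_UnionD)
    show "finite C" if "C \<in> rcosets\<^bsub>G\<^esub> S" for C
      using that G.rcosets_finite S.subset finS by blast
    show "pairwise disjnt (rcosets\<^bsub>G\<^esub> S)" by (rule G.rcos_disjoint[OF S])
    fix C D g h assume CD: "C \<in> rcosets\<^bsub>G\<^esub> S" "D \<in> rcosets\<^bsub>G\<^esub> S" "C \<noteq> D" and g: "g \<in> C" and h: "h \<in> D"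
    have hG: "h \<in> carrier G" and gG: "g \<in> carrier G" using CD g h G.rcosets_part_G[OF S] by blast+
    have "g \<otimes>\<^bsub>G\<^esub> inv\<^bsub>G\<^esub> h \<notin> S"
    proof
      assume "g \<otimes>\<^bsub>G\<^esub> inv\<^bsub>G\<^esub> h \<in> S"
      then have "g \<in> S #>\<^bsub>G\<^esub> h" unfolding r_coset_def
        using hG gG by (auto intro!: bexI[of _ "g \<otimes>\<^bsub>G\<^esub> inv\<^bsub>G\<^esub> h"] simp: G.m_assoc)
      moreover have "S #>\<^bsub>G\<^esub> h = D"
        using CD(2) h hG G.repr_independence[OF _ _ S] by (auto simp: RCOSETS_def)
      ultimately show False using CD g G.rcos_disjoint[OF S] by (auto simp: pairwise_def disjnt_def)
    qed
    then show "?A g h = 0" by simp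
  qed
  also have "\<dots> = group_det H ^ card (rcosets\<^bsub>G\<^esub> S)" by (simp add: block)
  also have "card (rcosets\<^bsub>G\<^esub> S) = card (carrier G) div card S"
  proof -
    have "card S > 0" using finS S.one_closed card_gt_0_iff by blast
    moreover have "card (carrier G) = card (rcosets\<^bsub>G\<^esub> S) * card S"
      using G.lagrange[OF S] by (simp add: Coset.order_def)
    ultimately show ?thesis by simp
  qed
  finally show ?thesis .
qed

section \<open>The cubic form of a group matrix\<close>

text \<open>
  With \<open>x = y = z\<close> this is the trace of the cube of the group matrix \<open>(x (g h\<inverse>))\<close>; the three
  arguments are kept apart in order to polarise that cubic polynomial.
\<close>

definition cubic_form ::
  "('a, 'm) monoid_scheme \<Rightarrow> ('a \<Rightarrow> complex) \<Rightarrow> ('a \<Rightarrow> complex) \<Rightarrow> ('a \<Rightarrow> complex) \<Rightarrow> complex" where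
  "cubic_form G x y z = (\<Sum>g \<in> carrier G. \<Sum>h \<in> carrier G. \<Sum>k \<in> carrier G.
      x (g \<otimes>\<^bsub>G\<^esub> inv\<^bsub>G\<^esub> h) * y (h \<otimes>\<^bsub>G\<^esub> inv\<^bsub>G\<^esub> k) * z (k \<otimes>\<^bsub>G\<^esub> inv\<^bsub>G\<^esub> g))"

lemma cubic_form_add:
  "cubic_form G (\<lambda>v. x v + x' v) y z = cubic_form G x y z + cubic_form G x' y z"
  "cubic_form G x (\<lambda>v. y v + y' v) z = cubic_form G x y z + cubic_form G x y' z"
  "cubic_form G x y (\<lambda>v. z v + z' v) = cubic_form G x y z + cubic_form G x y z'"
  by (simp_all add: cubic_form_def algebra_simps sum.distrib)

lemma cubic_form_cong:
  assumes "group G" and "\<And>v. v \<in> carrier G \<Longrightarrow> x v = x' v" "\<And>v. v \<in> carrier G \<Longrightarrow> y v = y' v"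
    "\<And>v. v \<in> carrier G \<Longrightarrow> z v = z' v"
  shows "cubic_form G x y z = cubic_form G x' y' z'"
proof -
  interpret group G by fact
  show ?thesis unfolding cubic_form_def by (intro sum.cong refl) (simp add: assms)
qed

definition delta :: "'a \<Rightarrow> 'a \<Rightarrow> complex" where
  "delta a v = (if v = a then 1 else 0)"

text \<open>
  For a given \<open>g\<close> the values \<open>g h\<inverse> = a\<close> and \<open>h k\<inverse> = b\<close> determine \<open>h\<close> and \<open>k\<close>, and then
  \<open>k g\<inverse> = (a b)\<inverse>\<close>.
\<close>

lemma cubic_form_delta:
  assumes "group G" "finite (carrier G)" and abc: "a \<in> carrier G" "b \<in> carrier G" "c \<in> carrier G"
  shows "cubic_form G (delta a) (delta b) (delta c) =
    of_nat (card (carrier G)) * of_bool (a \<otimes>\<^bsub>G\<^esub> b \<otimes>\<^bsub>G\<^esub> c = \<one>\<^bsub>G\<^esub>)"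
proof -
  interpret group G by fact
  have eq_iff: "u \<otimes>\<^bsub>G\<^esub> inv\<^bsub>G\<^esub> v = w \<longleftrightarrow> v = inv\<^bsub>G\<^esub> w \<otimes>\<^bsub>G\<^esub> u"
    if "u \<in> carrier G" "v \<in> carrier G" "w \<in> carrier G" for u v w
    using that by (metis inv_closed inv_solve_left inv_solve_right)
  have "(\<Sum>h \<in> carrier G. \<Sum>k \<in> carrier G. delta a (g \<otimes>\<^bsub>G\<^esub> inv\<^bsub>G\<^esub> h) *
      delta b (h \<otimes>\<^bsub>G\<^esub> inv\<^bsub>G\<^esub> k) * delta c (k \<otimes>\<^bsub>G\<^esub> inv\<^bsub>G\<^esub> g)) = of_bool (a \<otimes>\<^bsub>G\<^esub> b \<otimes>\<^bsub>G\<^esub> c = \<one>\<^bsub>G\<^esub>)"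
    if g: "g \<in> carrier G" for g
  proof -
    let ?h = "inv\<^bsub>G\<^esub> a \<otimes>\<^bsub>G\<^esub> g"
    let ?k = "inv\<^bsub>G\<^esub> b \<otimes>\<^bsub>G\<^esub> ?h"
    have h: "?h \<in> carrier G" and k: "?k \<in> carrier G" using g abc by auto
    have "(\<Sum>h \<in> carrier G. \<Sum>k \<in> carrier G. delta a (g \<otimes>\<^bsub>G\<^esub> inv\<^bsub>G\<^esub> h) *
        delta b (h \<otimes>\<^bsub>G\<^esub> inv\<^bsub>G\<^esub> k) * delta c (k \<otimes>\<^bsub>G\<^esub> inv\<^bsub>G\<^esub> g)) =
        (\<Sum>h \<in> carrier G. \<Sum>k \<in> carrier G. if k = ?k then
          if h = ?h then delta c (k \<otimes>\<^bsub>G\<^esub> inv\<^bsub>G\<^esub> g) else 0 else 0)"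
      using g abc by (intro sum.cong refl) (auto simp: delta_def eq_iff)
    also have "\<dots> = delta c (?k \<otimes>\<^bsub>G\<^esub> inv\<^bsub>G\<^esub> g)"
      using h k assms(2) by simp
    also have "?k \<otimes>\<^bsub>G\<^esub> inv\<^bsub>G\<^esub> g = inv\<^bsub>G\<^esub> (a \<otimes>\<^bsub>G\<^esub> b)"
      using g abc by (simp add: m_assoc inv_mult_group)
    also have "delta c (inv\<^bsub>G\<^esub> (a \<otimes>\<^bsub>G\<^esub> b)) = of_bool (a \<otimes>\<^bsub>G\<^esub> b \<otimes>\<^bsub>G\<^esub> c = \<one>\<^bsub>G\<^esub>)"
    proof -
      have "inv\<^bsub>G\<^esub> (a \<otimes>\<^bsub>G\<^esub> b) = c \<longleftrightarrow> a \<otimes>\<^bsub>G\<^esub> b \<otimes>\<^bsub>G\<^esub> c = \<one>\<^bsub>G\<^esub>"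
        using abc by (metis inv_closed inv_equality inv_inv m_closed r_inv)
      then show ?thesis by (simp add: delta_def)
    qed
    finally show ?thesis .
  qed
  then show ?thesis by (simp add: cubic_form_def)
qed

text \<open>
  The condition \<open>a b c = 1\<close> is invariant under cyclic rotation.
\<close>

lemma cubic_form_delta_cyclic:
  assumes G: "group G" "finite (carrier G)"
    and abc: "a \<in> carrier G" "b \<in> carrier G" "c \<in> carrier G"
  shows "cubic_form G (delta a) (delta b) (delta c) + cubic_form G (delta b) (delta c) (delta a)
      + cubic_form G (delta c) (delta a) (delta b) =
    3 * of_nat (card (carrier G)) * of_bool (a \<otimes>\<^bsub>G\<^esub> b \<otimes>\<^bsub>G\<^esub> c = \<one>\<^bsub>G\<^esub>)"
proof -
  interpret group G by fact
  have "b \<otimes>\<^bsub>G\<^esub> c \<otimes>\<^bsub>G\<^esub> a = \<one>\<^bsub>G\<^esub> \<longleftrightarrow> a \<otimes>\<^bsub>G\<^esub> b \<otimes>\<^bsub>G\<^esub> c = \<one>\<^bsub>G\<^esub>"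
    "c \<otimes>\<^bsub>G\<^esub> a \<otimes>\<^bsub>G\<^esub> b = \<one>\<^bsub>G\<^esub> \<longleftrightarrow> a \<otimes>\<^bsub>G\<^esub> b \<otimes>\<^bsub>G\<^esub> c = \<one>\<^bsub>G\<^esub>"
    using abc by (metis inv_comm m_assoc m_closed)+
  then show ?thesis using G abc by (simp add: cubic_form_delta)
qed

text \<open>
  The usual inclusion-exclusion formula for a cubic form.  The summands are grouped into the two
  cyclic classes of permutations.  Unlike a comparison of coefficients, this treats coinciding
  arguments and distinct ones alike.
\<close>

lemma cubic_form_polarisation:
  defines "F \<equiv> \<lambda>G x. cubic_form G x x x"
  shows "F G (\<lambda>v. x v + y v + z v) - F G (\<lambda>v. x v + y v) - F G (\<lambda>v. x v + z v) - F G (\<lambda>v. y v + z v)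
      + F G x + F G y + F G z =
    (cubic_form G x y z + cubic_form G y z x + cubic_form G z x y) +
    (cubic_form G x z y + cubic_form G z y x + cubic_form G y x z)"
  unfolding F_def by (simp add: cubic_form_add)

section \<open>From the determinant to products of three elements\<close>

text \<open>
  The variable of the unit element occurs exactly on the diagonal of the matrix, so giving it the
  value \<open>t - x 1\<close>, and every other variable \<open>x\<^sub>v\<close> the value \<open>- x v\<close>, evaluates the determinant to
  the characteristic polynomial of the group matrix at \<open>t\<close>.
\<close>

lemma eval_gen_group_det_eq_poly_char_poly:
  assumes "group G" "finite (carrier G)" "\<one>\<^bsub>G\<^esub> \<in> S"
    and e: "bij_betw e {0..<n} (carrier G)"
    and off: "\<And>v. v \<in> carrier G - S \<Longrightarrow> x v = 0"
    and y: "\<And>v. v \<in> S \<Longrightarrow> y v = (if v = \<one>\<^bsub>G\<^esub> then t else 0) - x v"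
  shows "eval_cpoly y (gen_group_det G S) =
    poly (char_poly (mat n n (\<lambda>(i, j). x (e i \<otimes>\<^bsub>G\<^esub> inv\<^bsub>G\<^esub> (e j))))) t"
proof -
  interpret group G by fact
  have eG: "e i \<in> carrier G" if "i < n" for i using e that by (auto simp: bij_betw_def)
  have one: "e i \<otimes>\<^bsub>G\<^esub> inv\<^bsub>G\<^esub> (e j) = \<one>\<^bsub>G\<^esub> \<longleftrightarrow> i = j" if "i < n" "j < n" for i j
  proof -
    have "e i \<otimes>\<^bsub>G\<^esub> inv\<^bsub>G\<^esub> (e j) = \<one>\<^bsub>G\<^esub> \<longleftrightarrow> e i = e j"
      using eG that by (metis inv_closed inv_equality inv_inv r_inv)
    also have "\<dots> \<longleftrightarrow> i = j"
      using e that by (auto simp: bij_betw_def inj_on_def)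
    finally show ?thesis .
  qed
  have entry: "eval_cpoly y (if u \<in> S then mvar u else 0) = (if u = \<one>\<^bsub>G\<^esub> then t else 0) - x u"
    if "u \<in> carrier G" for u
    using off[of u] y[of u] that assms(3) by auto
  have "eval_cpoly y (gen_group_det G S) = det (mat n n (\<lambda>(i, j).
      (if e i \<otimes>\<^bsub>G\<^esub> inv\<^bsub>G\<^esub> (e j) = \<one>\<^bsub>G\<^esub> then t else 0) - x (e i \<otimes>\<^bsub>G\<^esub> inv\<^bsub>G\<^esub> (e j))))"
    unfolding gen_group_det_def eval_cpoly_det_on
    unfolding det_on_eq_det[OF e]
    by (intro arg_cong[of _ _ det] eq_matI) (simp_all add: entry eG)
  also have "\<dots> = poly (char_poly (mat n n (\<lambda>(i, j). x (e i \<otimes>\<^bsub>G\<^esub> inv\<^bsub>G\<^esub> (e j))))) t"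
    by (subst poly_char_poly[of _ n], simp, intro arg_cong[of _ _ det] eq_matI) (simp_all add: one)
  finally show ?thesis .
qed

lemma trace_cube_group_matrix:
  assumes e: "bij_betw e {0..<n} (carrier G)"
  shows "trace_cube n (mat n n (\<lambda>(i, j). x (e i \<otimes>\<^bsub>G\<^esub> inv\<^bsub>G\<^esub> (e j)))) = cubic_form G x x x"
  unfolding cubic_form_def trace_cube_def
  by (simp add: lessThan_atLeast0 flip: sum.reindex_bij_betw[OF e])

text \<open>
  Both sides of the determinant identity are evaluated at the same point.  Since \<open>\<phi>\<close> matches the
  unit elements, the variable \<open>t\<close> stays on the diagonal on both sides, and the identity becomes
  \<open>char_poly A = char_poly B ^ m\<close> for the two group matrices.
\<close>

lemma cubic_form_eq_of_gen_group_det_eq: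
  fixes G :: "('a, 'm) monoid_scheme" and H :: "('b, 'n) monoid_scheme"
  assumes G: "group G" "finite (carrier G)" and H: "group H"
    and S: "S \<subseteq> carrier G" "\<one>\<^bsub>G\<^esub> \<in> S"
    and \<phi>: "bij_betw \<phi> (carrier H) S" "\<phi> \<one>\<^bsub>H\<^esub> = \<one>\<^bsub>G\<^esub>"
    and det: "gen_group_det G S = subst_vars \<phi> (group_det H ^ m)"
    and off: "\<And>v. v \<notin> S \<Longrightarrow> x v = 0"
  shows "cubic_form G x x x = of_nat m * cubic_form H (x \<circ> \<phi>) (x \<circ> \<phi>) (x \<circ> \<phi>)"
proof -
  interpret H: group H by fact
  have finH: "finite (carrier H)"
    using \<phi>(1) S(1) G(2) bij_betw_finite finite_subset by metis
  obtain e where e: "bij_betw e {0..<card (carrier G)} (carrier G)"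
    using ex_bij_betw_nat_finite[OF G(2)] by blast
  obtain f where f: "bij_betw f {0..<card (carrier H)} (carrier H)"
    using ex_bij_betw_nat_finite[OF finH] by blast
  define A where "A = mat (card (carrier G)) (card (carrier G))
    (\<lambda>(i, j). x (e i \<otimes>\<^bsub>G\<^esub> inv\<^bsub>G\<^esub> (e j)))"
  define B where "B = mat (card (carrier H)) (card (carrier H))
    (\<lambda>(i, j). (x \<circ> \<phi>) (f i \<otimes>\<^bsub>H\<^esub> inv\<^bsub>H\<^esub> (f j)))"
  have "poly (char_poly A) t = poly (char_poly B ^ m) t" for t
  proof -
    define y where "y v = (if v = \<one>\<^bsub>G\<^esub> then t else 0) - x v" for v
    have one: "\<phi> h = \<one>\<^bsub>G\<^esub> \<longleftrightarrow> h = \<one>\<^bsub>H\<^esub>" if "h \<in> carrier H" for h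
      using \<phi> that H.one_closed by (metis bij_betw_imp_inj_on inj_on_eq_iff)
    have "poly (char_poly A) t = eval_cpoly y (gen_group_det G S)"
      unfolding A_def
      by (rule eval_gen_group_det_eq_poly_char_poly[OF G S(2) e, symmetric]) (auto simp: off y_def)
    also have "\<dots> = eval_cpoly (y \<circ> \<phi>) (group_det H) ^ m"
      by (simp add: det eval_cpoly_subst_vars eval_cpoly_power)
    also have "eval_cpoly (y \<circ> \<phi>) (group_det H) = poly (char_poly B) t"
      unfolding B_def group_det_def
      by (rule eval_gen_group_det_eq_poly_char_poly[OF H finH _ f]) (auto simp: y_def one)
    finally show ?thesis by simp
  qed
  then have "char_poly A = char_poly B ^ m"
    by (simp add: poly_eq_poly_eq_iff[symmetric] fun_eq_iff)
  then have "trace_cube (card (carrier G)) A = of_nat m * trace_cube (card (carrier H)) B"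
    by (intro trace_cube_char_poly_power) (auto simp: A_def B_def)
  then show ?thesis
    unfolding A_def B_def trace_cube_group_matrix[OF e] trace_cube_group_matrix[OF f] .
qed

text \<open>
  The polarised cubic form at three indicator functions counts, up to the factor \<open>|G|\<close> or \<open>|H|\<close>,
  the orders of the three elements in which their product is the unit.  The six orders fall into
  two cyclic classes of three equivalent conditions each, and the factors \<open>|G|\<close> and \<open>m |H|\<close> agree,
  so they cancel.
\<close>

lemma triple_product_counts:
  fixes G :: "('a, 'm) monoid_scheme" and H :: "('b, 'n) monoid_scheme"
  assumes G: "group G" "finite (carrier G)" and H: "group H"
    and S: "S \<subseteq> carrier G" "\<one>\<^bsub>G\<^esub> \<in> S"
    and \<phi>: "bij_betw \<phi> (carrier H) S" "\<phi> \<one>\<^bsub>H\<^esub> = \<one>\<^bsub>G\<^esub>"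
    and det: "gen_group_det G S = subst_vars \<phi> (group_det H ^ m)"
    and m: "card (carrier G) = m * card (carrier H)"
    and abc: "a \<in> carrier H" "b \<in> carrier H" "c \<in> carrier H"
  shows "of_bool (\<phi> a \<otimes>\<^bsub>G\<^esub> \<phi> b \<otimes>\<^bsub>G\<^esub> \<phi> c = \<one>\<^bsub>G\<^esub>) + of_bool (\<phi> a \<otimes>\<^bsub>G\<^esub> \<phi> c \<otimes>\<^bsub>G\<^esub> \<phi> b = \<one>\<^bsub>G\<^esub>) =
    (of_bool (a \<otimes>\<^bsub>H\<^esub> b \<otimes>\<^bsub>H\<^esub> c = \<one>\<^bsub>H\<^esub>) + of_bool (a \<otimes>\<^bsub>H\<^esub> c \<otimes>\<^bsub>H\<^esub> b = \<one>\<^bsub>H\<^esub>) :: nat)"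
proof -
  interpret G: group G by fact
  interpret H: group H by fact
  have finH: "finite (carrier H)"
    using \<phi>(1) S(1) G(2) bij_betw_finite finite_subset by metis
  have \<phi>S: "\<phi> h \<in> S" and \<phi>G: "\<phi> h \<in> carrier G" if "h \<in> carrier H" for h
    using \<phi>(1) S(1) that by (auto simp: bij_betw_def)
  have delta: "(delta (\<phi> a) \<circ> \<phi>) h = delta a h" if "a \<in> carrier H" "h \<in> carrier H" for a h
    using \<phi>(1) that by (auto simp: delta_def bij_betw_def inj_on_def)
  let ?K = "\<lambda>u v w. cubic_form G (delta u) (delta v) (delta w)"
  let ?L = "\<lambda>u v w. cubic_form H (delta u) (delta v) (delta w)"
  define F where "F x = cubic_form G x x x" for x
  define E where "E x = cubic_form H x x x" for x
  have FE: "F x = of_nat m * E y"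
    if "\<And>v. v \<notin> S \<Longrightarrow> x v = 0" "\<And>h. h \<in> carrier H \<Longrightarrow> (x \<circ> \<phi>) h = y h" for x y
  proof -
    have "F x = of_nat m * E (x \<circ> \<phi>)"
      unfolding F_def E_def by (rule cubic_form_eq_of_gen_group_det_eq[OF G H S \<phi> det that(1)])
    also have "E (x \<circ> \<phi>) = E y"
      unfolding E_def by (rule cubic_form_cong[OF H]) (use that(2) in auto)
    finally show ?thesis .
  qed
  have off: "delta (\<phi> h) v = 0" if "h \<in> carrier H" "v \<notin> S" for h v
    using \<phi>S that by (auto simp: delta_def)
  have "(?K (\<phi> a) (\<phi> b) (\<phi> c) + ?K (\<phi> b) (\<phi> c) (\<phi> a) + ?K (\<phi> c) (\<phi> a) (\<phi> b)) +
      (?K (\<phi> a) (\<phi> c) (\<phi> b) + ?K (\<phi> c) (\<phi> b) (\<phi> a) + ?K (\<phi> b) (\<phi> a) (\<phi> c)) =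
    of_nat m * ((?L a b c + ?L b c a + ?L c a b) + (?L a c b + ?L c b a + ?L b a c))"
    unfolding cubic_form_polarisation[symmetric] F_def[symmetric] E_def[symmetric]
    unfolding right_diff_distrib distrib_left
    by (intro arg_cong2[of _ _ _ _ "(+)"] arg_cong2[of _ _ _ _ "(-)"] FE)
      (use abc off delta in auto)
  also have "?K (\<phi> a) (\<phi> b) (\<phi> c) + ?K (\<phi> b) (\<phi> c) (\<phi> a) + ?K (\<phi> c) (\<phi> a) (\<phi> b) =
      3 * of_nat (card (carrier G)) * of_bool (\<phi> a \<otimes>\<^bsub>G\<^esub> \<phi> b \<otimes>\<^bsub>G\<^esub> \<phi> c = \<one>\<^bsub>G\<^esub>)"
    by (rule cubic_form_delta_cyclic) (use G abc \<phi>G in auto)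
  also have "?K (\<phi> a) (\<phi> c) (\<phi> b) + ?K (\<phi> c) (\<phi> b) (\<phi> a) + ?K (\<phi> b) (\<phi> a) (\<phi> c) =
      3 * of_nat (card (carrier G)) * of_bool (\<phi> a \<otimes>\<^bsub>G\<^esub> \<phi> c \<otimes>\<^bsub>G\<^esub> \<phi> b = \<one>\<^bsub>G\<^esub>)"
    by (rule cubic_form_delta_cyclic) (use G abc \<phi>G in auto)
  also have "?L a b c + ?L b c a + ?L c a b = 3 * of_nat (card (carrier H)) * of_bool (a \<otimes>\<^bsub>H\<^esub> b \<otimes>\<^bsub>H\<^esub> c = \<one>\<^bsub>H\<^esub>)"
    by (rule cubic_form_delta_cyclic) (use H finH abc in auto)
  also have "?L a c b + ?L c b a + ?L b a c = 3 * of_nat (card (carrier H)) * of_bool (a \<otimes>\<^bsub>H\<^esub> c \<otimes>\<^bsub>H\<^esub> b = \<one>\<^bsub>H\<^esub>)"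
    by (rule cubic_form_delta_cyclic) (use H finH abc in auto)
  finally have "of_nat (3 * card (carrier G) *
      (of_bool (\<phi> a \<otimes>\<^bsub>G\<^esub> \<phi> b \<otimes>\<^bsub>G\<^esub> \<phi> c = \<one>\<^bsub>G\<^esub>) + of_bool (\<phi> a \<otimes>\<^bsub>G\<^esub> \<phi> c \<otimes>\<^bsub>G\<^esub> \<phi> b = \<one>\<^bsub>G\<^esub>))) =
    (of_nat (3 * card (carrier G) *
      (of_bool (a \<otimes>\<^bsub>H\<^esub> b \<otimes>\<^bsub>H\<^esub> c = \<one>\<^bsub>H\<^esub>) + of_bool (a \<otimes>\<^bsub>H\<^esub> c \<otimes>\<^bsub>H\<^esub> b = \<one>\<^bsub>H\<^esub>))) :: complex)"
    by (simp add: m algebra_simps)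
  then have "3 * card (carrier G) *
      (of_bool (\<phi> a \<otimes>\<^bsub>G\<^esub> \<phi> b \<otimes>\<^bsub>G\<^esub> \<phi> c = \<one>\<^bsub>G\<^esub>) + of_bool (\<phi> a \<otimes>\<^bsub>G\<^esub> \<phi> c \<otimes>\<^bsub>G\<^esub> \<phi> b = \<one>\<^bsub>G\<^esub>)) =
    3 * card (carrier G) *
      (of_bool (a \<otimes>\<^bsub>H\<^esub> b \<otimes>\<^bsub>H\<^esub> c = \<one>\<^bsub>H\<^esub>) + of_bool (a \<otimes>\<^bsub>H\<^esub> c \<otimes>\<^bsub>H\<^esub> b = \<one>\<^bsub>H\<^esub>))"
    by (simp only: of_nat_eq_iff)
  moreover have "3 * card (carrier G) \<noteq> 0" using G(2) G.one_closed by auto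
  ultimately show ?thesis
    by (simp only: mult_cancel1) blast
qed

lemma (in group) mult_inv_eq_one_iff:
  assumes "a \<in> carrier G" "b \<in> carrier G" "c \<in> carrier G"
  shows "a \<otimes> b \<otimes> inv c = \<one> \<longleftrightarrow> a \<otimes> b = c"
    and mult_inv_mult_eq_one_iff: "a \<otimes> inv c \<otimes> b = \<one> \<longleftrightarrow> b \<otimes> a = c"
proof -
  have *: "u \<otimes> v \<otimes> inv c = \<one> \<longleftrightarrow> u \<otimes> v = c" if "u \<in> carrier G" "v \<in> carrier G" for u v
    using that assms(3) by (metis inv_closed inv_equality inv_inv m_closed r_inv)
  show "a \<otimes> b \<otimes> inv c = \<one> \<longleftrightarrow> a \<otimes> b = c" using * assms(1,2) by blast
  have "a \<otimes> inv c \<otimes> b = \<one> \<longleftrightarrow> b \<otimes> a \<otimes> inv c = \<one>"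
    using assms by (metis inv_closed inv_comm m_assoc m_closed)
  then show "a \<otimes> inv c \<otimes> b = \<one> \<longleftrightarrow> b \<otimes> a = c" using *[of b a] assms by simp
qed

lemma of_bool_add_eq_iff:
  "of_bool P + of_bool Q = (of_bool R + of_bool T :: nat) \<longleftrightarrow>
    (P \<and> Q \<longleftrightarrow> R \<and> T) \<and> (P \<or> Q \<longleftrightarrow> R \<or> T)"
  by (cases P; cases Q; cases R; cases T) simp_all

text \<open>
  Taking \<open>c = 1\<close> shows that \<open>\<phi>\<close> commutes with inversion.  Taking \<open>c\<inverse>\<close> for \<open>c\<close> then shows that, for
  all \<open>a\<close>, \<open>b\<close>, \<open>c\<close>, as many of \<open>\<phi>(a) \<phi>(b)\<close>, \<open>\<phi>(b) \<phi>(a)\<close> equal \<open>\<phi>(c)\<close> as of \<open>a b\<close>, \<open>b a\<close> equal \<open>c\<close>.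
  If \<open>a\<close> and \<open>b\<close> commute, both products of the images are therefore \<open>\<phi>(a b)\<close>.  Otherwise
  \<open>\<phi>(a b)\<close> and \<open>\<phi>(b a)\<close> are two different values, each taken by one of the two products.
  In both cases \<open>\<phi>(a) \<phi>(b)\<close> lies in the image \<open>S\<close> of \<open>\<phi>\<close>.
\<close>

lemma subgroup_of_triple_product_counts:
  fixes G :: "('a, 'm) monoid_scheme" and H :: "('b, 'n) monoid_scheme"
  assumes G: "group G" and H: "group H" and S: "S \<subseteq> carrier G"
    and \<phi>: "bij_betw \<phi> (carrier H) S" "\<phi> \<one>\<^bsub>H\<^esub> = \<one>\<^bsub>G\<^esub>"
    and counts: "\<And>a b c. a \<in> carrier H \<Longrightarrow> b \<in> carrier H \<Longrightarrow> c \<in> carrier H \<Longrightarrow>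
      of_bool (\<phi> a \<otimes>\<^bsub>G\<^esub> \<phi> b \<otimes>\<^bsub>G\<^esub> \<phi> c = \<one>\<^bsub>G\<^esub>) + of_bool (\<phi> a \<otimes>\<^bsub>G\<^esub> \<phi> c \<otimes>\<^bsub>G\<^esub> \<phi> b = \<one>\<^bsub>G\<^esub>) =
      (of_bool (a \<otimes>\<^bsub>H\<^esub> b \<otimes>\<^bsub>H\<^esub> c = \<one>\<^bsub>H\<^esub>) + of_bool (a \<otimes>\<^bsub>H\<^esub> c \<otimes>\<^bsub>H\<^esub> b = \<one>\<^bsub>H\<^esub>) :: nat)"
  shows "subgroup S G"
proof -
  interpret G: group G by fact
  interpret H: group H by fact
  have \<phi>S: "\<phi> h \<in> S" and \<phi>G [simp]: "\<phi> h \<in> carrier G" if "h \<in> carrier H" for h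
    using \<phi>(1) S that by (auto simp: bij_betw_def)
  have inj: "\<phi> g = \<phi> h \<longleftrightarrow> g = h" if "g \<in> carrier H" "h \<in> carrier H" for g h
    using \<phi>(1) that by (auto simp: bij_betw_def inj_on_def)
  have inv: "\<phi> (inv\<^bsub>H\<^esub> h) = inv\<^bsub>G\<^esub> (\<phi> h)" if h: "h \<in> carrier H" for h
  proof -
    have "\<phi> h \<otimes>\<^bsub>G\<^esub> \<phi> (inv\<^bsub>H\<^esub> h) = \<one>\<^bsub>G\<^esub>"
      using counts[of h "inv\<^bsub>H\<^esub> h" "\<one>\<^bsub>H\<^esub>"] h unfolding of_bool_add_eq_iff by (simp add: \<phi>(2))
    then show ?thesis using h G.inv_comm G.inv_equality by force
  qed
  have prod: "(\<phi> a \<otimes>\<^bsub>G\<^esub> \<phi> b = \<phi> c \<and> \<phi> b \<otimes>\<^bsub>G\<^esub> \<phi> a = \<phi> c \<longleftrightarrow> a \<otimes>\<^bsub>H\<^esub> b = c \<and> b \<otimes>\<^bsub>H\<^esub> a = c) \<and>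
      (\<phi> a \<otimes>\<^bsub>G\<^esub> \<phi> b = \<phi> c \<or> \<phi> b \<otimes>\<^bsub>G\<^esub> \<phi> a = \<phi> c \<longleftrightarrow> a \<otimes>\<^bsub>H\<^esub> b = c \<or> b \<otimes>\<^bsub>H\<^esub> a = c)"
    if abc: "a \<in> carrier H" "b \<in> carrier H" "c \<in> carrier H" for a b c
    using counts[OF abc(1,2) H.inv_closed[OF abc(3)]]
    unfolding inv[OF abc(3)] of_bool_add_eq_iff
      G.mult_inv_eq_one_iff[OF \<phi>G[OF abc(1)] \<phi>G[OF abc(2)] \<phi>G[OF abc(3)]]
      G.mult_inv_mult_eq_one_iff[OF \<phi>G[OF abc(1)] \<phi>G[OF abc(2)] \<phi>G[OF abc(3)]]
      H.mult_inv_eq_one_iff[OF abc]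
      H.mult_inv_mult_eq_one_iff[OF abc] .
  have two_values: "x = p \<or> x = q" if "x = p \<or> y = p" "x = q \<or> y = q" "p \<noteq> q" for x y p q :: 'a
    using that by blast
  have mult: "\<phi> a \<otimes>\<^bsub>G\<^esub> \<phi> b \<in> S" if ab: "a \<in> carrier H" "b \<in> carrier H" for a b
  proof -
    have cl: "a \<otimes>\<^bsub>H\<^esub> b \<in> carrier H" "b \<otimes>\<^bsub>H\<^esub> a \<in> carrier H" using ab by simp_all
    have "\<phi> a \<otimes>\<^bsub>G\<^esub> \<phi> b = \<phi> (a \<otimes>\<^bsub>H\<^esub> b) \<or> \<phi> a \<otimes>\<^bsub>G\<^esub> \<phi> b = \<phi> (b \<otimes>\<^bsub>H\<^esub> a)"
    proof (cases "a \<otimes>\<^bsub>H\<^esub> b = b \<otimes>\<^bsub>H\<^esub> a")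
      case True
      then show ?thesis using prod[OF ab cl(1)] by simp
    next
      case False
      then have ne: "\<phi> (a \<otimes>\<^bsub>H\<^esub> b) \<noteq> \<phi> (b \<otimes>\<^bsub>H\<^esub> a)" using inj cl by blast
      have "\<phi> a \<otimes>\<^bsub>G\<^esub> \<phi> b = \<phi> (a \<otimes>\<^bsub>H\<^esub> b) \<or> \<phi> b \<otimes>\<^bsub>G\<^esub> \<phi> a = \<phi> (a \<otimes>\<^bsub>H\<^esub> b)"
        using prod[OF ab cl(1)] by simp
      moreover have "\<phi> a \<otimes>\<^bsub>G\<^esub> \<phi> b = \<phi> (b \<otimes>\<^bsub>H\<^esub> a) \<or> \<phi> b \<otimes>\<^bsub>G\<^esub> \<phi> a = \<phi> (b \<otimes>\<^bsub>H\<^esub> a)"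
        using prod[OF ab cl(2)] by simp
      ultimately show ?thesis using ne by (rule two_values)
    qed
    then show ?thesis using \<phi>S[OF cl(1)] \<phi>S[OF cl(2)] by (elim disjE) simp_all
  qed
  have S_eq: "S = \<phi> ` carrier H" using \<phi>(1) by (simp add: bij_betw_def)
  show ?thesis
  proof (rule G.subgroupI)
    show "S \<noteq> {}" using S_eq H.one_closed by blast
    show "inv\<^bsub>G\<^esub> a \<in> S" if "a \<in> S" for a
    proof -
      obtain h where "a = \<phi> h" "h \<in> carrier H" using \<open>a \<in> S\<close> S_eq by blast
      then show ?thesis using \<phi>S[of "inv\<^bsub>H\<^esub> h"] inv[of h] by simp
    qed
    show "a \<otimes>\<^bsub>G\<^esub> b \<in> S" if "a \<in> S" "b \<in> S" for a b
      using that mult unfolding S_eq by blast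
  qed (rule S)
qed

lemma subgroup_if_gen_group_det_eq:
  fixes G :: "('a, 'm) monoid_scheme" and H :: "('b, 'n) monoid_scheme"
  assumes G: "group G" "finite (carrier G)" and H: "group H"
    and S: "S \<subseteq> carrier G" "\<one>\<^bsub>G\<^esub> \<in> S" "card S dvd card (carrier G)"
    and \<phi>: "bij_betw \<phi> (carrier H) S" "\<phi> \<one>\<^bsub>H\<^esub> = \<one>\<^bsub>G\<^esub>"
    and det: "gen_group_det G S =
      subst_vars \<phi> (group_det H ^ (card (carrier G) div card (carrier H)))"
  shows "subgroup S G"
proof -
  have "card (carrier H) = card S" using \<phi>(1) by (rule bij_betw_same_card)
  then have "card (carrier G) = card (carrier G) div card (carrier H) * card (carrier H)"
    using S(3) by simp
  from triple_product_counts[OF G H S(1,2) \<phi> det this] show ?thesis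
    by (rule subgroup_of_triple_product_counts[OF G(1) H S(1) \<phi>])
qed

section \<open>The characterisation of subgroups\<close>

text \<open>
  If \<open>S\<close> is a subgroup, then \<open>S\<close> itself with the identity map serves as \<open>H\<close>.
\<close>

theorem theorem1p1:
  fixes G :: "('a, 'm) monoid_scheme" and S :: "'a set"
  assumes "group G" and "finite (carrier G)"
    and "S \<subseteq> carrier G" and "\<one>\<^bsub>G\<^esub> \<in> S" and "card S dvd card (carrier G)"
  shows "(subgroup S G \<longleftrightarrow>
      (\<exists>(H :: 'a monoid) \<phi>. group H \<and> bij_betw \<phi> (carrier H) S \<and> \<phi> \<one>\<^bsub>H\<^esub> = \<one>\<^bsub>G\<^esub> \<and>
        gen_group_det G S =
          subst_vars \<phi> (group_det H ^ (card (carrier G) div card (carrier H))))) \<and>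
    ((\<exists>(H :: 'b monoid) \<phi>. group H \<and> bij_betw \<phi> (carrier H) S \<and> \<phi> \<one>\<^bsub>H\<^esub> = \<one>\<^bsub>G\<^esub> \<and>
        gen_group_det G S =
          subst_vars \<phi> (group_det H ^ (card (carrier G) div card (carrier H)))) \<longrightarrow>
      subgroup S G)"
proof (intro conjI iffI impI)
  assume S: "subgroup S G"
  let ?H = "\<lparr>carrier = S, monoid.mult = monoid.mult G, one = \<one>\<^bsub>G\<^esub>\<rparr> :: 'a monoid"
  interpret G: group G by fact
  interpret S: subgroup S G by fact
  have H: "group ?H"
  proof (rule groupI)
    fix a assume "a \<in> carrier ?H"
    then show "\<exists>b \<in> carrier ?H. b \<otimes>\<^bsub>?H\<^esub> a = \<one>\<^bsub>?H\<^esub>"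
      by (intro bexI[of _ "inv\<^bsub>G\<^esub> a"]) auto
  qed (simp_all add: G.m_assoc)
  have "gen_group_det G S = group_det ?H ^ (card (carrier G) div card (carrier ?H))"
    using gen_group_det_subgroup[OF assms(1,2) S H] by simp
  moreover have "subst_vars id p = p" for p :: "'a cpoly"
    by (rule subst_vars_ident[of _ UNIV]) (simp_all add: polys_in_def)
  ultimately show "\<exists>(H :: 'a monoid) \<phi>. group H \<and> bij_betw \<phi> (carrier H) S \<and> \<phi> \<one>\<^bsub>H\<^esub> = \<one>\<^bsub>G\<^esub> \<and>
        gen_group_det G S =
          subst_vars \<phi> (group_det H ^ (card (carrier G) div card (carrier H)))"
    by (intro exI[of _ ?H] exI[of _ id]) (simp add: H)
qed (elim exE conjE, rule subgroup_if_gen_group_det_eq[OF assms(1,2) _ assms(3-5)], assumption+)+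

end
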